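(* Let $1\le p\le n$, let $f:\mathbb{R}^{n\times p}\to\mathbb{R}$ be continuously differentiable, and let $X\in\mathbb{R}^{n\times p}$ have full column rank. Then the Riemannian gradient at $X$ of $f$ on the Riemannian manifold $(\mathrm{St}_{X^\top X}(p,n),g)$ is $$\mathrm{grad} f(X)=\psi(X)X,\qquad \psi(X)=2\,\mathrm{skew}\big(\nabla f(X)X^\top\big).$$
   Context: Notation: $\mathbb{R}^{n\times p}_*$ is the set of real $n\times p$ matrices of full column rank; $\langle A,B\rangle=\mathrm{tr}(A^\top B)$ is the Frobenius inner product; $\mathrm{skew}(A)=\frac12(A-A^\top)$ for square $A$; $\nabla f(X)\in\mathbb{R}^{n\times p}$ is the Euclidean gradient of $f$ (with respect to the Frobenius inner product). For a symmetric positive-definite matrix $M\in\mathbb{R}^{p\times p}$, $\mathrm{St}_M(p,n)=\{Y\in\mathbb{R}^{n\times p}: Y^\top Y=M\}$, an embedded submanifold of $\mathbb{R}^{n\times p}_*$ (an open subset of $\mathbb{R}^{n\times p}$) with tangent space $\mathrm{T}_Y\mathrm{St}_M(p,n)=\{\xi\in\mathbb{R}^{n\times p}:\xi^\top Y+Y^\top\xi=0\}$ at $Y$. Every $X\in\mathbb{R}^{n\times p}_*$ belongs to $\mathrm{St}_{X^\top X}(p,n)$, where $M=X^\top X$. The Riemannian metric $g$ on $\mathbb{R}^{n\times p}_*$ is defined by $$g_Y(\xi,\zeta)=\Big\langle \xi,\big(I_n-\tfrac12 Y(Y^\top Y)^{-1}Y^\top\big)\zeta (Y^\top Y)^{-1}\Big\rangle,\qquad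 Y\in\mathbb{R}^{n\times p}_*,\ \xi,\zeta\in\mathbb{R}^{n\times p},$$ and $\mathrm{St}_M(p,n)$ carries the restriction of $g$ to its tangent spaces. The Riemannian gradient $\mathrm{grad} f(X)$ of $f$ at $X$ on $(\mathrm{St}_{X^\top X}(p,n),g)$ is the unique element of $\mathrm{T}_X\mathrm{St}_{X^\top X}(p,n)$ satisfying $g_X(\mathrm{grad} f(X),\xi)=\mathrm{D}f(X)[\xi]=\langle\nabla f(X),\xi\rangle$ for all $\xi\in \mathrm{T}_X\mathrm{St}_{X^\top X}(p,n)$. *)

theory Defs
  imports "HOL-Analysis.Analysis"
begin

text \<open>Real \<open>n \<times> p\<close> matrices are elements of \<^typ>\<open>real^'p^'n\<close>, with
  \<open>n = CARD('n)\<close> and \<open>p = CARD('p)\<close>.\<close>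

definition frob_inner :: "real^'p^'n \<Rightarrow> real^'p^'n \<Rightarrow> real"
  where "frob_inner A B = trace (transpose A ** B)"

lemma frob_inner_eq_inner: "frob_inner A B = A \<bullet> B"
proof -
  have "frob_inner A B = (\<Sum>j\<in>UNIV. \<Sum>i\<in>UNIV. A $ i $ j * B $ i $ j)"
    by (simp add: frob_inner_def trace_def transpose_def matrix_matrix_mult_def)
  also have "\<dots> = (\<Sum>i\<in>UNIV. \<Sum>j\<in>UNIV. A $ i $ j * B $ i $ j)"
    by (rule sum.swap)
  also have "\<dots> = A \<bullet> B"
    by (simp add: inner_vec_def)
  finally show ?thesis .
qed

definition skew_part :: "real^'n^'n \<Rightarrow> real^'n^'n"
  where "skew_part A = (1/2) *\<^sub>R (A - transpose A)"

definition full_column_rank :: "(real^'p^'n) set"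
  where "full_column_rank = {Y. rank Y = CARD('p)}"

definition continuously_differentiable ::
    "('a::real_normed_vector \<Rightarrow> 'b::real_normed_vector) \<Rightarrow> bool"
  where "continuously_differentiable f \<longleftrightarrow>
    (\<exists>f' :: 'a \<Rightarrow> 'a \<Rightarrow>\<^sub>L 'b.
       (\<forall>x. (f has_derivative blinfun_apply (f' x)) (at x)) \<and> continuous_on UNIV f')"

definition euclidean_gradient :: "(real^'p^'n \<Rightarrow> real) \<Rightarrow> real^'p^'n \<Rightarrow> real^'p^'n"
  where "euclidean_gradient f X = (THE G. (f has_derivative frob_inner G) (at X))"

definition St :: "real^'p^'p \<Rightarrow> (real^'p^'n) set"
  where "St M = {Y. transpose Y ** Y = M}"

text \<open>The tangent space at \<open>Y\<close> of the unique \<^term>\<open>St M\<close> containing \<open>Y\<close>;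
  the defining equation does not mention \<open>M\<close>.\<close>

definition tangent_St :: "real^'p^'n \<Rightarrow> (real^'p^'n) set"
  where "tangent_St Y = {\<xi>. transpose \<xi> ** Y + transpose Y ** \<xi> = 0}"

definition metric_g :: "real^'p^'n \<Rightarrow> real^'p^'n \<Rightarrow> real^'p^'n \<Rightarrow> real"
  where "metric_g Y \<xi> \<zeta> =
    frob_inner \<xi>
      ((mat 1 - (1/2) *\<^sub>R (Y ** matrix_inv (transpose Y ** Y) ** transpose Y))
        ** \<zeta> ** matrix_inv (transpose Y ** Y))"

definition is_riemannian_gradient ::
    "real^'p^'p \<Rightarrow> (real^'p^'n \<Rightarrow> real) \<Rightarrow> real^'p^'n \<Rightarrow> real^'p^'n \<Rightarrow> bool"
  where "is_riemannian_gradient M f X Z \<longleftrightarrow>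
    X \<in> St M \<and> Z \<in> tangent_St X \<and>
    (\<forall>\<xi>\<in>tangent_St X. metric_g X Z \<xi> = frechet_derivative f (at X) \<xi>)"

definition riemannian_gradient ::
    "real^'p^'p \<Rightarrow> (real^'p^'n \<Rightarrow> real) \<Rightarrow> real^'p^'n \<Rightarrow> real^'p^'n"
  where "riemannian_gradient M f X = (THE Z. is_riemannian_gradient M f X Z)"

definition psi :: "(real^'p^'n \<Rightarrow> real) \<Rightarrow> real^'p^'n \<Rightarrow> real^'n^'n"
  where "psi f X = 2 *\<^sub>R skew_part (euclidean_gradient f X ** transpose X)"

end

theory Submission
  imports Defs
begin

text \<open>Write \<open>S = X\<^sup>T X\<close>, \<open>P = X S\<^sup>-\<^sup>1 X\<^sup>T\<close> and let \<open>G\<close> be the Euclidean gradient. For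
  \<open>Z = (G X\<^sup>T - X G\<^sup>T) X\<close> one finds \<open>(I - P/2) Z S\<^sup>-\<^sup>1 = G - X K\<close> with \<open>K\<close> symmetric, and
  \<open>X K\<close> is Frobenius-orthogonal to the tangent space. Uniqueness is positive definiteness
  of the metric, which holds because \<open>I - P/2\<close> is the mean of \<open>I\<close> and the orthogonal projection \<open>I - P\<close>.\<close>

lemma matrix_diff_ldistrib:
  fixes A :: "'a::ring_1^'n^'m"
  shows "A ** (B - C) = A ** B - A ** C"
  by (simp add: matrix_matrix_mult_def vec_eq_iff right_diff_distrib sum_subtractf)

lemma matrix_diff_rdistrib:
  fixes A B :: "'a::ring_1^'n^'m"
  shows "(A - B) ** C = A ** C - B ** C"
  by (simp add: matrix_matrix_mult_def vec_eq_iff left_diff_distrib sum_subtractf)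

lemma transpose_diff: "transpose (A - B) = transpose A - transpose B"
  by (simp add: transpose_def vec_eq_iff)

text \<open>Both sides are the trace of the same product, so associativity suffices.\<close>

lemma inner_matrix_mult_left:
  fixes A :: "real^'p^'n" and B :: "real^'m^'n" and C :: "real^'p^'m"
  shows "A \<bullet> (B ** C) = (transpose B ** A) \<bullet> C"
proof -
  have "frob_inner A (B ** C) = frob_inner (transpose B ** A) C"
    by (simp add: frob_inner_def matrix_transpose_mul matrix_mul_assoc)
  then show ?thesis by (simp add: frob_inner_eq_inner)
qed

lemma inner_transpose:
  fixes A B :: "real^'p^'n"
  shows "transpose A \<bullet> transpose B = A \<bullet> B"
proof -
  have "transpose A \<bullet> transpose B = (\<Sum>j\<in>UNIV. \<Sum>i\<in>UNIV. A $ i $ j * B $ i $ j)"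
    by (simp add: inner_vec_def transpose_def)
  also have "\<dots> = (\<Sum>i\<in>UNIV. \<Sum>j\<in>UNIV. A $ i $ j * B $ i $ j)"
    by (rule sum.swap)
  finally show ?thesis by (simp add: inner_vec_def)
qed

text \<open>Transposition is a Frobenius isometry and turns right factors into left ones, which
  reduces this to \<open>inner_matrix_mult_left\<close>.\<close>

lemma inner_matrix_mult_right:
  fixes A :: "real^'p^'n" and B :: "real^'p^'m" and C :: "real^'m^'n"
  shows "A \<bullet> (C ** B) = (A ** transpose B) \<bullet> C"
proof -
  have "A \<bullet> (C ** B) = transpose A \<bullet> (transpose B ** transpose C)"
    by (metis inner_transpose matrix_transpose_mul)
  also have "\<dots> = transpose (A ** transpose B) \<bullet> transpose C"
    by (simp add: inner_matrix_mult_left matrix_transpose_mul)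
  finally show ?thesis by (simp only: inner_transpose)
qed

lemma matrix_inv_mult:
  fixes A :: "real^'n^'n"
  assumes "invertible A"
  shows "matrix_inv A ** A = mat 1" "A ** matrix_inv A = mat 1"
proof -
  have "\<exists>B. A ** B = mat 1 \<and> B ** A = mat 1"
    using assms by (simp add: invertible_def)
  then have "A ** matrix_inv A = mat 1 \<and> matrix_inv A ** A = mat 1"
    unfolding matrix_inv_def by (rule someI_ex)
  then show "matrix_inv A ** A = mat 1" "A ** matrix_inv A = mat 1" by auto
qed

lemma transpose_matrix_inv_symmetric:
  fixes A :: "real^'n^'n"
  assumes "invertible A" "transpose A = A"
  shows "transpose (matrix_inv A) = matrix_inv A"
proof -
  have "transpose (matrix_inv A) ** A = mat 1"
    by (metis assms matrix_inv_mult(2) matrix_transpose_mul transpose_mat)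
  then show ?thesis
    by (metis assms(1) matrix_inv_mult(2) matrix_mul_assoc matrix_mul_lid matrix_mul_rid)
qed

text \<open>The Gram matrix has the same kernel as \<open>X\<close>, because pairing its value at
  \<open>v\<close> with \<open>v\<close> gives the squared norm of \<open>X *v v\<close>; full
  column rank makes that kernel trivial.\<close>

lemma invertible_gram:
  fixes X :: "real^'p^'n"
  assumes "X \<in> full_column_rank"
  shows "invertible (transpose X ** X)"
proof -
  have inj: "inj ((*v) X)"
    using assms by (simp add: full_column_rank_def full_rank_injective)
  have "v = 0" if "(transpose X ** X) *v v = 0" for v
  proof -
    have "(X *v v) \<bullet> (X *v v) = v \<bullet> (transpose X *v (X *v v))"
      by (metis dot_lmul_matrix inner_commute transpose_matrix_vector)
    also have "\<dots> = 0"
      using that by (simp only: matrix_vector_mul_assoc inner_zero_right)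
    finally have "X *v v = X *v 0" by simp
    then show ?thesis using inj by (rule injD[rotated])
  qed
  then show ?thesis
    by (metis invertible_left_inverse matrix_left_invertible_ker)
qed

text \<open>Differentiability makes the \<open>THE\<close> in \<open>euclidean_gradient\<close>
  denote: the adjoint of the derivative, evaluated at 1, is its Riesz representative, and
  nondegeneracy of the inner product makes it unique.\<close>

lemma frechet_derivative_euclidean_gradient:
  fixes f :: "real^'p^'n \<Rightarrow> real"
  assumes "f differentiable (at X)"
  shows "frechet_derivative f (at X) \<xi> = euclidean_gradient f X \<bullet> \<xi>"
proof -
  let ?D = "frechet_derivative f (at X)"
  let ?G = "adjoint ?D 1"
  have D: "(f has_derivative ?D) (at X)"
    using assms frechet_derivative_works by blast
  then have "linear ?D" by (rule has_derivative_linear)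
  then have "?D \<xi> = ?G \<bullet> \<xi>" for \<xi>
    using adjoint_works[of ?D \<xi> 1] by (simp add: inner_commute)
  then have eq: "?D = frob_inner ?G"
    by (auto simp: frob_inner_eq_inner)
  have "euclidean_gradient f X = ?G"
    unfolding euclidean_gradient_def
  proof (rule the_equality)
    show "(f has_derivative frob_inner ?G) (at X)" using D eq by simp
  next
    fix G assume "(f has_derivative frob_inner G) (at X)"
    then have "frob_inner G = frob_inner ?G"
      using D eq has_derivative_unique by metis
    then have "G \<bullet> \<xi> = ?G \<bullet> \<xi>" for \<xi>
      by (metis frob_inner_eq_inner)
    then show "G = ?G" using vector_eq_rdot by blast
  qed
  then show ?thesis using eq by (metis frob_inner_eq_inner)
qed

lemma metric_g_diff_left: "metric_g Y (A - B) C = metric_g Y A C - metric_g Y B C"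
  by (simp add: metric_g_def frob_inner_eq_inner inner_diff_left)

lemma tangent_St_diff:
  assumes "A \<in> tangent_St Y" "B \<in> tangent_St Y"
  shows "A - B \<in> tangent_St Y"
  using assms
  by (simp add: tangent_St_def transpose_diff matrix_diff_ldistrib matrix_diff_rdistrib
      add_diff_add[symmetric])

lemma skew_mult_in_tangent_St:
  assumes "transpose A = - A"
  shows "A ** Y \<in> tangent_St Y"
proof -
  have "transpose Y ** (- A) ** Y = - (transpose Y ** A ** Y)"
    by (simp add: matrix_matrix_mult_def vec_eq_iff sum_negf)
  then show ?thesis
    by (simp add: tangent_St_def matrix_transpose_mul matrix_mul_assoc assms)
qed

text \<open>Tangency says that \<open>transpose Y ** \<xi>\<close> is skew. Moving \<open>Y\<close>
  across the inner product pairs this skew matrix with the symmetric \<open>K\<close>, and such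
  pairs are orthogonal.\<close>

lemma symmetric_mult_orthogonal_tangent_St:
  assumes "\<xi> \<in> tangent_St Y" "transpose K = K"
  shows "(Y ** K) \<bullet> \<xi> = 0"
proof -
  let ?A = "transpose Y ** \<xi>"
  have "transpose ?A + ?A = 0"
    using assms(1) by (simp add: tangent_St_def matrix_transpose_mul)
  moreover have "K \<bullet> transpose ?A = K \<bullet> ?A"
    by (metis assms(2) inner_transpose)
  ultimately have "K \<bullet> ?A = 0"
    by (metis inner_add_right inner_zero_right mult_2 mult_eq_0_iff zero_neq_numeral)
  moreover have "(Y ** K) \<bullet> \<xi> = K \<bullet> ?A"
    by (simp add: inner_matrix_mult_left)
  ultimately show ?thesis by simp
qed

context
  fixes X :: "real^'p^'n" and W :: "real^'p^'p" and P :: "real^'n^'n"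
  defines "W \<equiv> matrix_inv (transpose X ** X)"
    and "P \<equiv> X ** W ** transpose X"
  assumes X: "X \<in> full_column_rank"
begin

lemma W_inverse: "W ** (transpose X ** X) = mat 1" "transpose X ** X ** W = mat 1"
  unfolding W_def by (simp_all add: matrix_inv_mult invertible_gram X)

lemma transpose_W: "transpose W = W"
  unfolding W_def
  by (simp add: transpose_matrix_inv_symmetric invertible_gram X matrix_transpose_mul)

lemma transpose_P: "transpose P = P"
  by (simp add: P_def matrix_transpose_mul transpose_W matrix_mul_assoc)

text \<open>The weights \<open>W\<close> and I - P/2 are symmetric, so both can be moved onto
  \<open>A\<close>. This leaves \<open>B\<close> bare, ready for comparison with the Euclidean
  pairing.\<close>

lemma metric_g_eq: "metric_g X A B = (A ** W - (1/2) *\<^sub>R (P ** A ** W)) \<bullet> B"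
proof -
  have "metric_g X A B = A \<bullet> ((mat 1 - (1/2) *\<^sub>R P) ** B ** W)"
    by (simp add: metric_g_def frob_inner_eq_inner W_def P_def)
  also have "\<dots> = (transpose (mat 1 - (1/2) *\<^sub>R P) ** (A ** W)) \<bullet> B"
    by (simp only: inner_matrix_mult_right[of _ _ W] transpose_W inner_matrix_mult_left[of _ _ B])
  also have "transpose (mat 1 - (1/2) *\<^sub>R P) = mat 1 - (1/2) *\<^sub>R transpose P"
    by (simp add: transpose_def mat_def vec_eq_iff)
  finally show ?thesis
    by (simp add: transpose_P matrix_diff_rdistrib scalar_matrix_assoc matrix_mul_assoc)
qed

lemma metric_g_eq_0_imp:
  assumes "metric_g X D D = 0"
  shows "D = 0"
proof -
  \<comment> \<open>\<open>E\<close> is chosen with \<open>E ** X = D\<close>, so that it absorbs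
    the weight \<open>W\<close>: the pairing of \<open>D ** W\<close> with \<open>D\<close> becomes
    the plain squared norm of \<open>E\<close>.\<close>
  define E where "E = D ** W ** transpose X"
  have PP: "P ** P = P"
  proof -
    have "P ** P = X ** (W ** (transpose X ** X)) ** W ** transpose X"
      by (simp only: P_def matrix_mul_assoc)
    then show ?thesis by (simp add: W_inverse P_def)
  qed
  have EX: "E ** X = D"
    by (metis E_def W_inverse(1) matrix_mul_assoc matrix_mul_rid)
  have *: "(A ** W) \<bullet> D = (A ** W ** transpose X) \<bullet> E" for A
    by (metis EX inner_matrix_mult_right)
  have "metric_g X D D = E \<bullet> E - (1/2) * ((P ** E) \<bullet> E)"
    using *[of D] *[of "P ** D"]
    by (simp add: metric_g_eq inner_diff_left E_def matrix_mul_assoc)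
  \<comment> \<open>\<open>P\<close> is symmetric and idempotent, so Pythagoras bounds this pairing
    by the squared norm of \<open>E\<close>. The metric value is then at least half that squared
    norm.\<close>
  moreover have "(P ** E) \<bullet> E = (P ** E) \<bullet> (P ** E)"
    by (simp add: inner_matrix_mult_left transpose_P matrix_mul_assoc PP)
  then have "(E - P ** E) \<bullet> (E - P ** E) = E \<bullet> E - (P ** E) \<bullet> E"
    by (simp add: inner_diff_left inner_diff_right inner_commute)
  then have "(P ** E) \<bullet> E \<le> E \<bullet> E"
    by (metis diff_ge_0_iff_ge inner_ge_zero)
  ultimately have "E \<bullet> E \<le> 0" using assms by simp
  then have "E = 0" by (meson inner_eq_zero_iff inner_ge_zero order_antisym)
  then show ?thesis using EX by simp
qed

lemma metric_g_skew_mult: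
  fixes G :: "real^'p^'n"
  assumes "\<xi> \<in> tangent_St X"
  shows "metric_g X ((G ** transpose X - X ** transpose G) ** X) \<xi> = G \<bullet> \<xi>"
proof -
  define Z where "Z = (G ** transpose X - X ** transpose G) ** X"
  define A where "A = transpose G ** X ** W"
  \<comment> \<open>Applying I - P/2 to G - XA, with PG = X \<open>transpose A\<close> and PX = X,
    gives G - XA - (X \<open>transpose A\<close> - XA)/2. Hence the symmetric part of
    \<open>A\<close> appears.\<close>
  define K where "K = (1/2) *\<^sub>R (A + transpose A)"
  have "Z ** W = G ** (transpose X ** X ** W) - X ** A"
    by (simp add: Z_def A_def matrix_diff_rdistrib matrix_mul_assoc)
  then have ZW: "Z ** W = G - X ** A"
    by (simp add: W_inverse)
  have "transpose A = W ** transpose X ** G"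
    by (simp add: A_def matrix_transpose_mul transpose_W matrix_mul_assoc)
  then have PG: "P ** G = X ** transpose A"
    by (simp add: P_def matrix_mul_assoc)
  have "P ** X = X ** (W ** (transpose X ** X))"
    by (simp only: P_def matrix_mul_assoc)
  then have PX: "P ** X = X" by (simp add: W_inverse)
  have "P ** Z ** W = P ** (Z ** W)" by (simp add: matrix_mul_assoc)
  also have "\<dots> = X ** transpose A - X ** A"
    by (simp add: ZW matrix_diff_ldistrib PG matrix_mul_assoc PX)
  finally have PZW: "P ** Z ** W = X ** transpose A - X ** A" .
  have XK: "X ** K = (1/2) *\<^sub>R (X ** A + X ** transpose A)"
    by (simp add: K_def matrix_add_ldistrib matrix_scalar_ac scaleR_add_right flip: scalar_matrix_assoc)
  \<comment> \<open>Splitting \<open>X ** A\<close> into halves lets one half cancel against the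
    projected term.\<close>
  have half: "a = (1/2) *\<^sub>R a + (1/2) *\<^sub>R a" for a :: "real^'p^'n"
    by (simp flip: scaleR_add_left)
  have "Z ** W - (1/2) *\<^sub>R (P ** Z ** W) = G - X ** K"
    using half[of "X ** A"] by (simp add: ZW PZW XK algebra_simps)
  moreover have "transpose K = K"
    by (simp add: K_def transpose_def vec_eq_iff)
  ultimately show ?thesis
    using assms
    by (simp add: metric_g_eq flip: Z_def)
       (simp add: inner_diff_left symmetric_mult_orthogonal_tangent_St)
qed

end

theorem proposition4:
  fixes f :: "real^'p^'n \<Rightarrow> real" and X :: "real^'p^'n"
  assumes "1 \<le> CARD('p)" and "CARD('p) \<le> CARD('n)"
    and "continuously_differentiable f"
    and "X \<in> full_column_rank"
  shows "(\<exists>!Z. is_riemannian_gradient (transpose X ** X) f X Z) \<and>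
    riemannian_gradient (transpose X ** X) f X = psi f X ** X"
proof -
  have X: "X \<in> full_column_rank" by fact
  let ?G = "euclidean_gradient f X"
  have "f differentiable (at X)"
    using assms(3) by (auto simp: continuously_differentiable_def differentiable_def)
  note D = frechet_derivative_euclidean_gradient[OF this]
  \<comment> \<open>The factor 2 in \<open>psi\<close> cancels the 1/2 in
    \<open>skew_part\<close>.\<close>
  have psi: "psi f X = ?G ** transpose X - X ** transpose ?G"
    by (simp add: psi_def skew_part_def matrix_transpose_mul)
  have "transpose (psi f X) = - psi f X"
    by (simp add: psi_def skew_part_def transpose_def vec_eq_iff)
  \<comment> \<open>\<open>psi f X\<close> stays folded at first, so that its skewness yields
    tangency; it is expanded only for the metric identity.\<close>
  then have grad: "is_riemannian_gradient (transpose X ** X) f X (psi f X ** X)"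
    by (simp add: is_riemannian_gradient_def St_def skew_mult_in_tangent_St D)
       (simp add: psi metric_g_skew_mult[OF X])
  have unique: "Z = psi f X ** X" if "is_riemannian_gradient (transpose X ** X) f X Z" for Z
  proof -
    \<comment> \<open>The difference of two gradients is tangent and pairs to zero with every
      tangent vector, hence with itself.\<close>
    let ?E = "Z - psi f X ** X"
    have "?E \<in> tangent_St X"
      using that grad by (simp add: is_riemannian_gradient_def tangent_St_diff)
    then have "metric_g X ?E ?E = 0"
      using that grad by (simp add: is_riemannian_gradient_def metric_g_diff_left)
    then show ?thesis
      using metric_g_eq_0_imp[OF X] by fastforce
  qed
  then have "riemannian_gradient (transpose X ** X) f X = psi f X ** X"
    unfolding riemannian_gradient_def using grad by (rule the_equality[rotated])
  with grad unique show ?thesis by blast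
qed

end
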